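(* Let $[d]=(d_0,\dots,d_J)$, $J\in\{1,2,\dots\}$, be a multi-index with $P([d])\ge1$ and let $(\hat f_{\theta_t})_{t\in\mathbb N}$, $\theta_t\in\mathbb R^{P([d])}$, be a sequence in $\mathcal{NN}^{\mathrm{(P)ReLU}}_{[d]}$. Then for every "latent code dimension" $Q\in\{1,2,\dots\}$ with $Q+P([d])\ge12$ and every "coding complexity parameter" $\delta>0$ there are a ReLU feedforward network $\hat h:\mathbb R^{P([d])+Q}\to\mathbb R^{P([d])+Q}$, an initial latent code $z_0\in\mathbb R^{P([d])+Q}$, and a linear map $L:\mathbb R^{P([d])+Q}\to\mathbb R^{P([d])}$ such that $$\hat f_{L(z_t)}=\hat f_{\theta_t},\qquad z_{t+1}=\hat h(z_t)$$ for every $t=0,\dots,T$, where $T:=\lfloor\delta^{-Q}\rfloor$. Moreover: (i) $\hat h$ has width at most $(P([d])+Q)T+12$; (ii) $\hat h$ has depth at most of the order $$\mathcal O\Big(T\Big(1+\sqrt{T\log T}\Big(1+\tfrac{\log2}{\log T}\Big[C_d+\tfrac{\log(T^22^{1/2})-\log\delta}{\log2}\Big]_+\Big)\Big)\Big);$$ (iii) the number of non-zero parameters of $\hat h$ is at most $$\mathcal O\Big(T^3(P([d])+Q)^2\Big(1+(P([d])+Q)\sqrt{T\log T}\Big(1+\tfrac{\log2}{\log T}\Big[C_d+\tfrac{\log(T^22^{1/2})-\log\delta}{\log2}\Big]_+\Big)\Big)\Big),$$ where $$C_d=\frac{2\log(5\sqrt{2\pi})+3\log(P([d])+Q)-\log(P([d])+Q+1)}{2\log2}.$$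 (The estimates (ii), (iii) are understood for $T\ge2$.)
   Context: $\mathbb N=\{0,1,2,\dots\}$, $[u]_+=\max\{u,0\}$. For $a\in\mathbb R$ let $\sigma_a(x)=\max\{x,ax\}$, applied componentwise ($a=0$ is ReLU). For a multi-index $[d]=(d_0,\dots,d_J)$ put $P([d])=J+\sum_{j=0}^{J-1}d_j(d_{j+1}+1)+d_J$. A parameter $\theta\in\mathbb R^{P([d])}$ is identified with $((A^{(j)},b^{(j)},a^{(j)})_{j=0}^{J-1},c)$, where $A^{(j)}\in\mathbb R^{d_{j+1}\times d_j}$, $b^{(j)}\in\mathbb R^{d_j}$, $a^{(j)}\in\mathbb R$, $c\in\mathbb R^{d_J}$, and defines $\hat f_\theta:\mathbb R^{d_0}\to\mathbb R^{d_J}$ by $\hat f_\theta(x)=x^{(J)}+c$, $x^{(0)}=x$, $x^{(j+1)}=A^{(j)}\sigma_{a^{(j)}}(x^{(j)}+b^{(j)})$ for $0\le j\le J-1$. $\mathcal{NN}^{\mathrm{(P)ReLU}}_{[d]}$ is the set of all such $\hat f_\theta$; a ReLU feedforward network has all $a^{(j)}=0$. Width is $\max_jd_j$; depth is $J$. The implied constants in $\mathcal O(\cdot)$ are absolute.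
   Formalization: The width bound in (i) is proved as max{P([d])+Q, (P([d])+Q)T+12}; this differs from the stated bound only when T=0 and P([d])+Q>12, where width at most 12 is impossible since the input dimension P([d])+Q already exceeds 12. *)

theory Defs
  imports "Jordan_Normal_Form.VS_Connect" Complex_Main
begin

text \<open>
  A multi-index \<open>[d] = (d\<^sub>0, \<dots>, d\<^sub>J)\<close> is a list \<open>d\<close> of length \<open>J + 1\<close>.
  The space \<open>\<real>\<^sup>n\<close> is \<open>carrier_vec n :: real vec set\<close>.
\<close>

definition depth :: "nat list \<Rightarrow> nat" where
  "depth d = length d - 1"

definition width :: "nat list \<Rightarrow> nat" where
  "width d = Max (set d)"

definition num_params :: "nat list \<Rightarrow> nat" where
  "num_params d = depth d + (\<Sum>j<depth d. d ! j * (d ! Suc j + 1)) + d ! depth d"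

definition prelu :: "real \<Rightarrow> real vec \<Rightarrow> real vec" where
  "prelu a = map_vec (\<lambda>x. max x (a * x))"

text \<open>
  The flat vector \<open>\<theta>\<close> lists, for \<open>j = 0, \<dots>, J - 1\<close> in turn, the entries of \<open>A\<^bsup>(j)\<^esup>\<close> (row by row),
  those of \<open>b\<^bsup>(j)\<^esup>\<close>, and the number \<open>a\<^bsup>(j)\<^esup>\<close>; the entries of \<open>c\<close> come last.
  Block \<open>j\<close> starts at \<open>offset d j\<close>, and \<open>offset d J + d\<^sub>J = num_params d\<close>.
\<close>

definition offset :: "nat list \<Rightarrow> nat \<Rightarrow> nat" where
  "offset d j = (\<Sum>i<j. d ! i * (d ! Suc i + 1) + 1)"

definition weight :: "nat list \<Rightarrow> real vec \<Rightarrow> nat \<Rightarrow> real mat" where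
  "weight d \<theta> j = mat (d ! Suc j) (d ! j) (\<lambda>(r, s). \<theta> $ (offset d j + r * d ! j + s))"

definition bias :: "nat list \<Rightarrow> real vec \<Rightarrow> nat \<Rightarrow> real vec" where
  "bias d \<theta> j = vec (d ! j) (\<lambda>i. \<theta> $ (offset d j + d ! Suc j * d ! j + i))"

definition slope :: "nat list \<Rightarrow> real vec \<Rightarrow> nat \<Rightarrow> real" where
  "slope d \<theta> j = \<theta> $ (offset d j + d ! Suc j * d ! j + d ! j)"

definition out_bias :: "nat list \<Rightarrow> real vec \<Rightarrow> real vec" where
  "out_bias d \<theta> = vec (d ! depth d) (\<lambda>i. \<theta> $ (offset d (depth d) + i))"

fun layer :: "nat list \<Rightarrow> real vec \<Rightarrow> real vec \<Rightarrow> nat \<Rightarrow> real vec" where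
  "layer d \<theta> x 0 = x"
| "layer d \<theta> x (Suc j) = weight d \<theta> j *\<^sub>v prelu (slope d \<theta> j) (layer d \<theta> x j + bias d \<theta> j)"

definition network :: "nat list \<Rightarrow> real vec \<Rightarrow> real vec \<Rightarrow> real vec" where
  "network d \<theta> x = layer d \<theta> x (depth d) + out_bias d \<theta>"

definition is_relu :: "nat list \<Rightarrow> real vec \<Rightarrow> bool" where
  "is_relu d \<theta> \<longleftrightarrow> (\<forall>j<depth d. slope d \<theta> j = 0)"

definition nonzero_params :: "real vec \<Rightarrow> nat" where
  "nonzero_params \<theta> = card {i. i < dim_vec \<theta> \<and> \<theta> $ i \<noteq> 0}"

abbreviation linear_vec :: "nat \<Rightarrow> nat \<Rightarrow> (real vec \<Rightarrow> real vec) \<Rightarrow> bool" where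
  "linear_vec n m L \<equiv>
     linear_map class_ring (module_vec TYPE(real) n) (module_vec TYPE(real) m) L"

text \<open>\<open>N\<close> stands for the total dimension \<open>P([d]) + Q\<close> of the latent space.\<close>

definition C_const :: "nat \<Rightarrow> real" where
  "C_const N = (2 * ln (5 * sqrt (2 * pi)) + 3 * ln (real N) - ln (real N + 1)) / (2 * ln 2)"

definition memory_factor :: "nat \<Rightarrow> nat \<Rightarrow> real \<Rightarrow> real" where
  "memory_factor N T \<delta> =
     sqrt (real T * ln (real T)) *
       (1 + ln 2 / ln (real T) *
          max 0 (C_const N + (ln ((real T)\<^sup>2 * 2 powr (1 / 2)) - ln \<delta>) / ln 2))"

end

theory Submission
  imports Defs
begin

text \<open>
  One spare latent coordinate suffices as a clock: with \<open>z\<^sub>t = (\<theta>\<^sub>t, t, 0, \<dots>, 0)\<close> and \<open>L\<close> the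
  projection to the first \<open>P\<close> coordinates, the map \<open>z\<^sub>t \<mapsto> z\<^sub>t\<^sub>+\<^sub>1\<close>, \<open>t \<le> T\<close>, only has to
  interpolate \<open>T + 1\<close> values as a function of the real number \<open>t\<close>. A piecewise linear function with
  breakpoints \<open>0, \<dots>, T - 1\<close> does this, and it is a ReLU network with layer widths \<open>N, T, N\<close>.
  The claimed bounds then hold with room to spare, because the number of all parameters of this
  network is at most \<open>8 T N\<close>.
\<close>

text \<open>
  In the induction step the new summand vanishes at all earlier nodes, so \<open>s n\<close> can be read off
  from the value at \<open>Suc n\<close>.
\<close>

lemma relu_interpolation:
  fixes f :: "nat \<Rightarrow> real"
  shows "\<exists>s. \<forall>t\<le>n. f t = (\<Sum>k<n. s k * max 0 (real t - real k)) + f 0"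
proof (induction n)
  case 0
  then show ?case by simp
next
  case (Suc n)
  then obtain s where s: "f t = (\<Sum>k<n. s k * max 0 (real t - real k)) + f 0" if "t \<le> n" for t
    by blast
  define s' where
    "s' = s(n := f (Suc n) - f 0 - (\<Sum>k<n. s k * max 0 (real (Suc n) - real k)))"
  have sum_s': "(\<Sum>k<n. s' k * max 0 (x - real k)) = (\<Sum>k<n. s k * max 0 (x - real k))" for x
    by (intro sum.cong) (auto simp: s'_def)
  have "f t = (\<Sum>k<Suc n. s' k * max 0 (real t - real k)) + f 0" if "t \<le> Suc n" for t
  proof (cases "t = Suc n")
    case True
    then show ?thesis by (simp only: sum.lessThan_Suc sum_s') (simp add: s'_def)
  next
    case False
    then have "t \<le> n" using that by simp
    then show ?thesis by (simp add: sum_s' s[symmetric])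
  qed
  then show ?case by blast
qed

lemma num_params_two_layer:
  "num_params [n, k, m] = 2 + n * (k + 1) + k * (m + 1) + m"
  by (simp add: num_params_def depth_def numeral_2_eq_2)

lemma index_less_mult: "r * n + s < k * n" if "r < k" "s < n" for r s k n :: nat
proof -
  have "r * n + s < Suc r * n" using that by simp
  also have "\<dots> \<le> k * n" using that by (intro mult_le_mono1) simp
  finally show ?thesis .
qed

text \<open>The blocks of the flat parameter vector occupy disjoint index ranges, so they can be
  prescribed independently. Networks can then be built from matrices and biases, without further
  index arithmetic. Zero slopes make both activations ReLU.\<close>

lemma two_layer_relu_parameters:
  fixes n k m :: nat and A B :: "nat \<Rightarrow> nat \<Rightarrow> real" and b c :: "nat \<Rightarrow> real"
  defines "e \<equiv> [n, k, m]"
  obtains \<eta> where "\<eta> \<in> carrier_vec (num_params e)" "is_relu e \<eta>"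
    "weight e \<eta> 0 = mat k n (\<lambda>(r, s). A r s)" "bias e \<eta> 0 = 0\<^sub>v n"
    "weight e \<eta> 1 = mat m k (\<lambda>(r, s). B r s)" "bias e \<eta> 1 = vec k b" "out_bias e \<eta> = vec m c"
proof -
  \<comment> \<open>\<open>p\<close> is the offset of the second block and \<open>q\<close> that of
    the output bias.\<close>
  define p where "p = n * (k + 1) + 1"
  define q where "q = p + k * (m + 1) + 1"
  \<comment> \<open>The cases follow the storage order, with \<open>div\<close> and
    \<open>mod\<close> decoding the row-major matrices. The first zero range covers the first bias
    and the first slope; the second is the single index \<open>q - 1\<close>, the second
    slope.\<close>
  define \<eta> where "\<eta> = vec (num_params e) (\<lambda>i.
    if i < k * n then A (i div n) (i mod n)
    else if i < p then 0
    else if i - p < m * k then B ((i - p) div k) ((i - p) mod k)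
    else if i - p < m * k + k then b (i - p - m * k)
    else if i < q then 0
    else c (i - q))"
  have P: "num_params e = q + m" by (simp add: e_def num_params_two_layer p_def q_def)
  have off: "offset e 0 = 0" "offset e (Suc 0) = p" "offset e (Suc (Suc 0)) = q"
    by (simp_all add: offset_def e_def p_def q_def)
  have dep: "depth e = Suc (Suc 0)" by (simp add: e_def depth_def)
  have e: "e ! 0 = n" "e ! Suc 0 = k" "e ! Suc (Suc 0) = m" by (simp_all add: e_def)
  \<comment> \<open>In this form the comparisons that select a case are linear in the block sizes
    \<open>k * n\<close> and \<open>m * k\<close>.\<close>
  have p: "p = k * n + n + 1" and q: "q = p + m * k + k + 1"
    by (simp_all add: p_def q_def algebra_simps)
  have nth: "\<eta> $ i =
    (if i < k * n then A (i div n) (i mod n)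
    else if i < p then 0
    else if i - p < m * k then B ((i - p) div k) ((i - p) mod k)
    else if i - p < m * k + k then b (i - p - m * k)
    else if i < q then 0
    else c (i - q))" if "i < q + m" for i
    using that by (simp add: \<eta>_def P)
  show thesis
  proof
    show "\<eta> \<in> carrier_vec (num_params e)" by (simp add: \<eta>_def)
    have "slope e \<eta> 0 = 0" "slope e \<eta> (Suc 0) = 0"
      by (simp_all add: slope_def off e nth p q)
    then show "is_relu e \<eta>" by (auto simp: is_relu_def dep less_Suc_eq)
    show "weight e \<eta> 0 = mat k n (\<lambda>(r, s). A r s)"
    proof (rule eq_matI)
      fix r s assume "r < dim_row (mat k n (\<lambda>(r, s). A r s))" "s < dim_col (mat k n (\<lambda>(r, s). A r s))"
      then have rs: "r < k" "s < n" by simp_all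
      have "r * n + s < k * n" by (rule index_less_mult) fact+
      then show "weight e \<eta> 0 $$ (r, s) = mat k n (\<lambda>(r, s). A r s) $$ (r, s)"
        using rs by (simp add: weight_def off e nth p q)
    qed (simp_all add: weight_def e)
    show "bias e \<eta> 0 = 0\<^sub>v n"
      by (rule eq_vecI) (auto simp: bias_def off e nth p q)
    show "weight e \<eta> 1 = mat m k (\<lambda>(r, s). B r s)"
    proof (rule eq_matI)
      fix r s assume "r < dim_row (mat m k (\<lambda>(r, s). B r s))" "s < dim_col (mat m k (\<lambda>(r, s). B r s))"
      then have rs: "r < m" "s < k" by simp_all
      have "r * k + s < m * k" by (rule index_less_mult) fact+
      then show "weight e \<eta> 1 $$ (r, s) = mat m k (\<lambda>(r, s). B r s) $$ (r, s)"
        using rs by (simp add: weight_def off e nth p q)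
    qed (simp_all add: weight_def e)
    show "bias e \<eta> 1 = vec k b"
      by (rule eq_vecI) (auto simp: bias_def off e nth p q)
    show "out_bias e \<eta> = vec m c"
      by (rule eq_vecI) (auto simp: out_bias_def dep off e nth p q)
  qed
qed

text \<open>Coordinate \<open>p\<close> of the input tells the time. The first matrix copies it to
  all \<open>k\<close> hidden units, the second bias shifts unit \<open>j\<close> by
  \<open>- real j\<close>, and ReLU yields the hinges \<open>max 0 (real t - real j)\<close>. The
  second matrix combines these with the interpolation coefficients of each output coordinate, and
  \<open>y 0\<close> is the output bias.\<close>

lemma two_layer_interpolation:
  fixes x y :: "nat \<Rightarrow> real vec"
  assumes x: "\<And>t. t \<le> k \<Longrightarrow> x t \<in> carrier_vec n" and y: "\<And>t. t \<le> k \<Longrightarrow> y t \<in> carrier_vec m"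
    and p: "p < n" "\<And>t. t \<le> k \<Longrightarrow> x t $ p = real t"
  obtains \<eta> where "\<eta> \<in> carrier_vec (num_params [n, k, m])" "is_relu [n, k, m] \<eta>"
    "\<And>t. t \<le> k \<Longrightarrow> network [n, k, m] \<eta> (x t) = y t"
proof -
  define e where "e = [n, k, m]"
  have "\<exists>s. \<forall>t\<le>k. y t $ i = (\<Sum>j<k. s j * max 0 (real t - real j)) + y 0 $ i" for i
    using relu_interpolation[of k "\<lambda>t. y t $ i"] .
  then obtain s where
    s: "\<And>i t. t \<le> k \<Longrightarrow> y t $ i = (\<Sum>j<k. s i j * max 0 (real t - real j)) + y 0 $ i"
    by metis
  obtain \<eta> where \<eta>: "\<eta> \<in> carrier_vec (num_params e)" "is_relu e \<eta>"
    "weight e \<eta> 0 = mat k n (\<lambda>(r, s). of_bool (s = p))" "bias e \<eta> 0 = 0\<^sub>v n"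
    "weight e \<eta> 1 = mat m k (\<lambda>(r, j). s r j)" "bias e \<eta> 1 = vec k (\<lambda>j. - real j)"
    "out_bias e \<eta> = vec m (\<lambda>i. y 0 $ i)"
    unfolding e_def by (rule two_layer_relu_parameters)
  have slope: "slope e \<eta> 0 = 0" "slope e \<eta> 1 = 0" and dep: "depth e = 2"
    using \<eta>(2) by (simp_all add: is_relu_def depth_def e_def)
  have net: "network e \<eta> (x t) = y t" if t: "t \<le> k" for t
  proof -
    have "layer e \<eta> (x t) 1 = vec k (\<lambda>_. real t)"
    proof (rule eq_vecI)
      fix r assume "r < dim_vec (vec k (\<lambda>_. real t))"
      then have r: "r < k" by simp
      \<comment> \<open>The activation precedes the matrix, so it also hits the input; coordinate
        \<open>p\<close> survives because \<open>real t\<close> is non-negative.\<close>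
      have "layer e \<eta> (x t) 1 $ r = (\<Sum>j\<in>{0..<n}. of_bool (j = p) * max (x t $ j) 0)"
        using x[OF t] r by (simp add: \<eta> slope prelu_def scalar_prod_def)
      also have "\<dots> = (\<Sum>j\<in>{0..<n}. if j = p then max (x t $ j) 0 else 0)"
        by (intro sum.cong) auto
      also have "\<dots> = real t" using p t by simp
      finally show "layer e \<eta> (x t) 1 $ r = vec k (\<lambda>_. real t) $ r" using r by simp
    qed (simp add: \<eta>)
    then have "layer e \<eta> (x t) 2
        = mat m k (\<lambda>(r, j). s r j) *\<^sub>v prelu 0 (vec k (\<lambda>_. real t) + vec k (\<lambda>j. - real j))"
      using \<eta> slope by (simp add: numeral_2_eq_2)
    also have "\<dots> = vec m (\<lambda>i. \<Sum>j<k. s i j * max 0 (real t - real j))"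
      by (rule eq_vecI)
        (auto simp: prelu_def scalar_prod_def lessThan_atLeast0 max.commute intro!: sum.cong)
    finally show ?thesis
      using y[OF t] s[OF t] by (auto simp: network_def dep \<eta> intro!: eq_vecI)
  qed
  show thesis using that \<eta>(1,2) net unfolding e_def by blast
qed

lemma linear_vec_vec_first: "linear_vec n m (\<lambda>v. vec_first v m)" if "m \<le> n"
proof -
  have "(\<lambda>v. vec_first v m) \<in>
      LinearCombinations.module_hom class_ring (module_vec TYPE(real) n) (module_vec TYPE(real) m)"
    using that by (auto simp: LinearCombinations.module_hom_def module_vec_simps vec_first_def)
  then show ?thesis
    by (intro linear_map.intro mod_hom.intro mod_hom_axioms.intro vec_vs vec_module)
qed

lemma nonzero_params_le_dim: "nonzero_params \<eta> \<le> dim_vec \<eta>"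
proof -
  have "nonzero_params \<eta> \<le> card {..<dim_vec \<eta>}"
    unfolding nonzero_params_def by (intro card_mono) auto
  then show ?thesis by simp
qed

text \<open>For \<open>T \<ge> 2\<close> the logarithm of \<open>T\<close> is positive. This allows
  the factors \<open>1 + ...\<close> in the claimed bounds to be estimated from below by 1.\<close>

lemma memory_factor_nonneg: "memory_factor N T \<delta> \<ge> 0" if "T \<ge> 2"
  using that unfolding memory_factor_def
  by (intro mult_nonneg_nonneg add_nonneg_nonneg divide_nonneg_nonneg) auto

lemma latent_dynamics:
  fixes \<theta> :: "nat \<Rightarrow> real vec"
  assumes \<theta>: "\<And>t. \<theta> t \<in> carrier_vec P" and Q: "Q \<ge> 1" and N: "N = P + Q"
  obtains \<eta> z where "\<eta> \<in> carrier_vec (num_params [N, T, N])" "is_relu [N, T, N] \<eta>"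
    "\<And>t. z t \<in> carrier_vec N" "\<And>t. vec_first (z t) P = \<theta> t"
    "\<And>t. t \<le> T \<Longrightarrow> z (Suc t) = network [N, T, N] \<eta> (z t)"
proof -
  \<comment> \<open>As \<open>Q \<ge> 1\<close>, coordinate \<open>P\<close> exists and can serve as
    the clock. It separates the states even where \<open>\<theta>\<close> repeats a value, so the
    successor is a function of the state.\<close>
  define z :: "nat \<Rightarrow> real vec" where
    "z t = vec N (\<lambda>i. if i < P then \<theta> t $ i else if i = P then real t else 0)" for t
  have z: "z t \<in> carrier_vec N" for t by (simp add: z_def)
  have "P < N" "z t $ P = real t" for t using Q N by (simp_all add: z_def)
  then obtain \<eta> where "\<eta> \<in> carrier_vec (num_params [N, T, N])" "is_relu [N, T, N] \<eta>"
    "\<And>t. t \<le> T \<Longrightarrow> network [N, T, N] \<eta> (z t) = z (Suc t)"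
    using two_layer_interpolation[of T z N "\<lambda>t. z (Suc t)" N P] z by blast
  moreover have "vec_first (z t) P = \<theta> t" for t
    using \<theta>[of t] N by (auto simp: vec_first_def z_def intro!: eq_vecI)
  ultimately show thesis using that[of \<eta> z] z by simp
qed

theorem lemma5:
  shows "\<exists>K1 K2 :: real. K1 > 0 \<and> K2 > 0 \<and>
    (\<forall>(d :: nat list) (\<theta> :: nat \<Rightarrow> real vec) (Q :: nat) (\<delta> :: real) (P :: nat) (N :: nat) (T :: nat).
      depth d \<ge> 1 \<and> P = num_params d \<and> P \<ge> 1 \<and> (\<forall>t. \<theta> t \<in> carrier_vec P) \<and>
      Q \<ge> 1 \<and> Q + P \<ge> 12 \<and> \<delta> > 0 \<and>
      N = P + Q \<and> T = nat \<lfloor>\<delta> powr (- real Q)\<rfloor> \<longrightarrow>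
      (\<exists>(e :: nat list) (\<eta> :: real vec) (z :: nat \<Rightarrow> real vec) (L :: real vec \<Rightarrow> real vec).
        depth e \<ge> 1 \<and> e ! 0 = N \<and> e ! depth e = N \<and>
        \<eta> \<in> carrier_vec (num_params e) \<and> is_relu e \<eta> \<and>
        z 0 \<in> carrier_vec N \<and> linear_vec N P L \<and>
        (\<forall>t\<le>T. (\<forall>x \<in> carrier_vec (d ! 0). network d (L (z t)) x = network d (\<theta> t) x) \<and>
               z (Suc t) = network e \<eta> (z t)) \<and>
        width e \<le> max N (N * T + 12) \<and>
        (T \<ge> 2 \<longrightarrow>
          real (depth e) \<le> K1 * (real T * (1 + memory_factor N T \<delta>)) \<and>
          real (nonzero_params \<eta>) \<le> K2 * (real T ^ 3 * (real N)\<^sup>2 * (1 + real N * memory_factor N T \<delta>)))))"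
\<comment> \<open>The constant 1 works for the depth because the depth is 2 and
  \<open>T \<ge> 2\<close>; the constant 8 comes from the parameter count.\<close>
proof (rule exI[of _ 1], rule exI[of _ 8], intro conjI allI impI, goal_cases)
  case (3 d \<theta> Q \<delta> P N T)
  then have \<theta>: "\<And>t. \<theta> t \<in> carrier_vec P" and Q: "Q \<ge> 1" and N: "N = P + Q" "N \<ge> 1"
    by auto
  obtain \<eta> z where \<eta>: "\<eta> \<in> carrier_vec (num_params [N, T, N])" "is_relu [N, T, N] \<eta>"
    and z: "\<And>t. z t \<in> carrier_vec N" "\<And>t. vec_first (z t) P = \<theta> t"
      "\<And>t. t \<le> T \<Longrightarrow> z (Suc t) = network [N, T, N] \<eta> (z t)"
    by (rule latent_dynamics[of \<theta>, OF \<theta> Q N(1), of T]) blast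
  have width: "width [N, T, N] \<le> max N (N * T + 12)"
  proof -
    \<comment> \<open>This bounds the hidden layer; the two outer layers have width
      \<open>N\<close>, the other argument of the maximum, which matters when
      \<open>T = 0\<close>.\<close>
    have "T \<le> N * T + 12" using mult_le_mono1[OF N(2), of T] by linarith
    then show ?thesis by (auto simp: width_def max_def)
  qed
  have dep: "depth [N, T, N] = 2" by (simp add: depth_def)
  have bounds: "real 2 \<le> 1 * (real T * (1 + memory_factor N T \<delta>)) \<and>
    real (nonzero_params \<eta>) \<le> 8 * (real T ^ 3 * (real N)\<^sup>2 * (1 + real N * memory_factor N T \<delta>))"
    if T: "T \<ge> 2"
  proof
    note nonneg = memory_factor_nonneg[OF T, of N \<delta>]
    have "real 2 * 1 \<le> real T * (1 + memory_factor N T \<delta>)"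
      using T nonneg by (intro mult_mono) auto
    then show "real 2 \<le> 1 * (real T * (1 + memory_factor N T \<delta>))" by simp
    have le: "1 \<le> T * N" "N \<le> T * N" "T \<le> T * N" using T N(2) by simp_all
    have "nonzero_params \<eta> \<le> num_params [N, T, N]"
      using nonzero_params_le_dim[of \<eta>] \<eta>(1) by simp
    also have "\<dots> = 2 + 2 * (T * N) + 2 * N + T"
      by (simp add: num_params_two_layer algebra_simps)
    \<comment> \<open>Each of 1, \<open>N\<close> and \<open>T\<close> is at most
      \<open>T * N\<close>, so the sum is in fact at most \<open>7 * (T * N)\<close>.\<close>
    also have "\<dots> \<le> 8 * (T * N)" using le by linarith
    also have "\<dots> \<le> 8 * (T ^ 3 * N\<^sup>2)"
      using T N(2) by (intro mult_le_mono) (auto intro: self_le_power)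
    finally have "real (nonzero_params \<eta>) \<le> 8 * (real T ^ 3 * (real N)\<^sup>2) * 1"
      by (simp flip: of_nat_power of_nat_mult)
    also have "\<dots> \<le> 8 * (real T ^ 3 * (real N)\<^sup>2) * (1 + real N * memory_factor N T \<delta>)"
      using nonneg by (intro mult_left_mono) auto
    finally show "real (nonzero_params \<eta>)
        \<le> 8 * (real T ^ 3 * (real N)\<^sup>2 * (1 + real N * memory_factor N T \<delta>))"
      by (simp add: mult.assoc)
  qed
  show ?case
    by (rule exI[of _ "[N, T, N]"], rule exI[of _ \<eta>], rule exI[of _ z],
        rule exI[of _ "\<lambda>v. vec_first v P"], unfold dep)
      (use \<eta> z width bounds linear_vec_vec_first[of P N] N in simp)
qed simp_all

end
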